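(* Let $\beta^0\in\mathbb{R}^p$, let $f$ be a fixed penalty of max-linear form (see context) with pattern function $I$, let $C\in\mathbb{R}^{p\times p}$ be positive definite, and let $W$ be a centered random vector in $\mathbb{R}^p$ with sub-gaussian entries. For each $\alpha>0$, let $(\hat\beta_n)=(\hat\beta_n^{\alpha})$ be the sequence of estimators obtained with the scaled penalty $f_n=n^{1/2}\alpha f$, and assume that $\sqrt n(\hat\beta_n-\beta^0)$ converges weakly and weakly in pattern to the minimizer $\hat u$ of $$V(u)=\tfrac12u^TCu-u^TW+\alpha f'(\beta^0;u).$$ Assume that the asymptotic irrepresentability condition $$C^{1/2}PC^{-1/2}v_0\in\operatorname{ri}(\partial f(\beta^0))$$ holds, where $P$ is the orthogonal projection onto $C^{1/2}\langle U_{\beta^0}\rangle$ and $v_0\in\partial f(\beta^0)$. Then there is a constant $c>0$, not depending on $\alpha$, such that $$\lim_{n\to\infty}\mathbb P[I(\hat\beta_n)=I(\beta^0)]\ge1-2e^{-c\alpha^2}.$$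
   Context: Max-linear form: a penalty $f:\mathbb{R}^p\to\mathbb{R}$ is of max-linear form if $f(x)=\max\{\langle v_i,x\rangle:i\in\mathcal S\}+g(x)$, where $\mathcal S$ is a finite index set, $g:\mathbb{R}^p\to\mathbb{R}$ is convex and continuously differentiable, and $v_i$ ($i\in\mathcal S$) are distinct vectors in $\mathbb{R}^p$ such that $v_i$ is not in the convex hull of $\{v_j:j\neq i\}$ for every $i\in\mathcal S$. Pattern: $I(x)=I_f(x)=\operatorname{argmax}_{i\in\mathcal S}\langle v_i,x\rangle\subset\mathcal S$; the set of patterns is $\mathfrak P_f=\{I_f(x):x\in\mathbb{R}^p\}$. Weak convergence in pattern of random vectors $\hat u_n$ to $\hat u$: $\lim_{n\to\infty}\mathbb P[I_h(\hat u_n)=\mathfrak p]=\mathbb P[I_h(\hat u)=\mathfrak p]$ for every $\mathfrak p\in\mathfrak P_h$ and every penalty $h$ of max-linear form on $\mathbb{R}^p$. Pattern space of $f$ at $x$: $\langle U_x\rangle=\operatorname{span}\{u\in\mathbb{R}^p:I(u)=I(x)\}$. $\partial f$ is the convex subdifferential, $f'(x;u)=\lim_{t\downarrow0}\frac{f(x+tu)-f(x)}{t}$, $\operatorname{ri}$ is the relative interior (with respect to the affine hull), and $C^{1/2}$ is the symmetric positive definite square root of $C$. The vector $C^{1/2}PC^{-1/2}v_0$ does not depend on the choice of $v_0\in\partial f(\beta^0)$. The only property of the estimators that is used is the assumed weak convergence and weak convergence in pattern; $W$, $C$, $f$, $\beta^0$ are the same for all $\alpha$. *)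

theory Defs
  imports "HOL-Probability.Probability"
begin

text \<open>
  Penalties of max-linear form. The representation \<open>(S, v, g)\<close> is carried explicitly because
  patterns are sets of indices. Nonemptiness of \<open>S\<close> is implicit in the
  maximum being a real number.
\<close>

definition continuously_differentiable :: "(real ^ 'p \<Rightarrow> real) \<Rightarrow> bool" where
  "continuously_differentiable g \<longleftrightarrow>
     (\<exists>Dg. (\<forall>x. GDERIV g x :> Dg x) \<and> continuous_on UNIV Dg)"

definition max_linear_form ::
  "(real ^ 'p \<Rightarrow> real) \<Rightarrow> 'i set \<Rightarrow> ('i \<Rightarrow> real ^ 'p) \<Rightarrow> (real ^ 'p \<Rightarrow> real) \<Rightarrow> bool" where
  "max_linear_form f S v g \<longleftrightarrow>
     finite S \<and> S \<noteq> {} \<and> inj_on v S \<and>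
     (\<forall>i\<in>S. v i \<notin> convex hull (v ` (S - {i}))) \<and>
     convex_on UNIV g \<and> continuously_differentiable g \<and>
     (\<forall>x. f x = Max ((\<lambda>i. v i \<bullet> x) ` S) + g x)"

definition pattern :: "'i set \<Rightarrow> ('i \<Rightarrow> real ^ 'p) \<Rightarrow> real ^ 'p \<Rightarrow> 'i set" where
  "pattern S v x = {i \<in> S. \<forall>j\<in>S. v j \<bullet> x \<le> v i \<bullet> x}"

definition pattern_space :: "'i set \<Rightarrow> ('i \<Rightarrow> real ^ 'p) \<Rightarrow> real ^ 'p \<Rightarrow> (real ^ 'p) set" where
  "pattern_space S v x = span {u. pattern S v u = pattern S v x}"

definition subdifferential :: "(real ^ 'p \<Rightarrow> real) \<Rightarrow> real ^ 'p \<Rightarrow> (real ^ 'p) set" where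
  "subdifferential f x = {w. \<forall>y. f y \<ge> f x + w \<bullet> (y - x)}"

definition dir_deriv :: "(real ^ 'p \<Rightarrow> real) \<Rightarrow> real ^ 'p \<Rightarrow> real ^ 'p \<Rightarrow> real" where
  "dir_deriv f x u = Lim (at_right 0) (\<lambda>t. (f (x + t *\<^sub>R u) - f x) / t)"

definition positive_definite :: "real ^ 'p ^ 'p \<Rightarrow> bool" where
  "positive_definite C \<longleftrightarrow> transpose C = C \<and> (\<forall>x. x \<noteq> 0 \<longrightarrow> x \<bullet> (C *v x) > 0)"

definition matrix_sqrt :: "real ^ 'p ^ 'p \<Rightarrow> real ^ 'p ^ 'p" where
  "matrix_sqrt C = (THE R. positive_definite R \<and> R ** R = C)"

definition orth_proj :: "(real ^ 'p) set \<Rightarrow> real ^ 'p \<Rightarrow> real ^ 'p" where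
  "orth_proj U x = (THE y. y \<in> U \<and> (\<forall>z\<in>U. orthogonal (x - y) z))"

definition limit_objective ::
  "real ^ 'p ^ 'p \<Rightarrow> (real ^ 'p \<Rightarrow> real) \<Rightarrow> real ^ 'p \<Rightarrow> real \<Rightarrow> real ^ 'p \<Rightarrow> real ^ 'p \<Rightarrow> real" where
  "limit_objective C f \<beta>\<^sub>0 \<alpha> w u =
     1 / 2 * (u \<bullet> (C *v u)) - u \<bullet> w + \<alpha> * dir_deriv f \<beta>\<^sub>0 u"

definition sub_gaussian :: "'w measure \<Rightarrow> ('w \<Rightarrow> real) \<Rightarrow> bool" where
  "sub_gaussian N X \<longleftrightarrow> X \<in> borel_measurable N \<and>
     (\<exists>K>0. \<forall>t\<ge>0. measure N {\<omega> \<in> space N. \<bar>X \<omega>\<bar> \<ge> t} \<le> 2 * exp (- (t\<^sup>2 / K\<^sup>2)))"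

text \<open>
  In both notions of convergence the \<open>n\<close>-th random vector may live on its own probability
  space \<open>M n\<close>, and the limit lives on \<open>N\<close>.
\<close>

definition converges_weakly ::
  "(nat \<Rightarrow> 'a measure) \<Rightarrow> (nat \<Rightarrow> 'a \<Rightarrow> real ^ 'p) \<Rightarrow> 'w measure \<Rightarrow> ('w \<Rightarrow> real ^ 'p) \<Rightarrow> bool" where
  "converges_weakly M X N Y \<longleftrightarrow>
     (\<forall>\<phi> :: real ^ 'p \<Rightarrow> real. continuous_on UNIV \<phi> \<and> bounded (range \<phi>) \<longrightarrow>
        (\<lambda>n. \<integral>\<omega>. \<phi> (X n \<omega>) \<partial>M n) \<longlonglongrightarrow> (\<integral>\<omega>. \<phi> (Y \<omega>) \<partial>N))"

text \<open>
  The quantification over all penalties \<open>h\<close> of max-linear form uses index sets of natural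
  numbers, because a definition cannot quantify over types; every finite index set is in
  bijection with such a set, and the events below do not depend on how indices are named.
\<close>

definition converges_weakly_in_pattern ::
  "(nat \<Rightarrow> 'a measure) \<Rightarrow> (nat \<Rightarrow> 'a \<Rightarrow> real ^ 'p) \<Rightarrow> 'w measure \<Rightarrow> ('w \<Rightarrow> real ^ 'p) \<Rightarrow> bool" where
  "converges_weakly_in_pattern M X N Y \<longleftrightarrow>
     (\<forall>h (T :: nat set) w k. max_linear_form h T w k \<longrightarrow>
        (\<forall>\<pp> \<in> range (pattern T w).
           (\<lambda>n. measure (M n) {\<omega> \<in> space (M n). pattern T w (X n \<omega>) = \<pp>})
             \<longlonglongrightarrow> measure N {\<omega> \<in> space N. pattern T w (Y \<omega>) = \<pp>}))"

end

theory Submission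
  imports Defs
begin

text \<open>
  Let \<open>I\<close> be the pattern of \<open>\<beta>\<^sub>0\<close> and \<open>U\<close> its pattern space, i.e. the vectors on which all
  \<open>v i\<close> with \<open>i \<in> I\<close> agree. Near \<open>\<beta>\<^sub>0\<close> the pattern of \<open>\<beta>\<^sub>0 + y\<close> is the pattern of \<open>y\<close>
  with respect to the subfamily \<open>I\<close>, so tightness and convergence in pattern for the penalty
  \<open>max {v i \<bullet> x | i \<in> I}\<close> identify the limit as the probability that the limiting minimizer
  lies in \<open>U\<close>.

  With \<open>R = C\<^sup>1\<^sup>/\<^sup>2\<close> and \<open>P\<close> the projection onto \<open>R U\<close>, the minimizer \<open>u\<close> over \<open>U\<close> satisfies
  \<open>W - C u = \<alpha> a + R (1 - P) R\<^sup>-\<^sup>1 W\<close>, where \<open>a\<close> is the vector of the irrepresentability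
  condition. The second summand is orthogonal to \<open>U\<close>, i.e. parallel to the affine hull of the
  subdifferential, so as \<open>a\<close> is a relative interior point, \<open>u\<close> is the global minimizer as soon
  as \<open>norm W\<close> is below a fixed multiple of \<open>\<alpha>\<close>. The sub-gaussian tail of \<open>norm W\<close> concludes.
\<close>

section \<open>Square roots of positive definite matrices and orthogonal projections\<close>

text \<open>A maximizer of the Rayleigh quotient on the unit sphere of \<open>U\<close> is an
  eigenvector. Working in an invariant subspace allows a repeated application on the orthogonal
  complement of the eigenvectors already found.\<close>

lemma selfadjoint_eigenvector:
  fixes T :: "'a::euclidean_space \<Rightarrow> 'a"
  assumes T: "linear T" and sa: "\<And>x y. T x \<bullet> y = x \<bullet> T y"
    and U: "subspace U" "T ` U \<subseteq> U" "U \<noteq> {0}"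
  shows "\<exists>x\<in>U. \<exists>c. norm x = 1 \<and> T x = c *\<^sub>R x"
proof -
  interpret T: linear T by fact
  let ?K = "sphere 0 1 \<inter> U"
  obtain y where y: "y \<in> U" "y \<noteq> 0"
    using U(1,3) subspace_0 by blast
  have "compact ?K"
    by (intro compact_Int_closed closed_subspace U) auto
  moreover have "y /\<^sub>R norm y \<in> ?K"
    using y U(1) by (auto intro: subspace_scale)
  moreover have "continuous_on ?K (\<lambda>x. x \<bullet> T x)"
    by (intro continuous_intros linear_continuous_on) (use T in \<open>simp add: linear_conv_bounded_linear\<close>)
  ultimately obtain x where x: "x \<in> ?K" and max: "\<And>z. z \<in> ?K \<Longrightarrow> z \<bullet> T z \<le> x \<bullet> T x"
    using continuous_attains_sup[of ?K "\<lambda>x. x \<bullet> T x"] by blast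
  define c where "c = x \<bullet> T x"
  \<comment> \<open>\<open>q\<close> is nonnegative on \<open>U\<close> and vanishes at
    \<open>x\<close>; a small move from \<open>x\<close> along the residual \<open>w\<close> would
    make it negative unless \<open>w = 0\<close>.\<close>
  define q where "q z = c * (z \<bullet> z) - z \<bullet> T z" for z
  have q_nonneg: "q z \<ge> 0" if "z \<in> U" for z
  proof (cases "z = 0")
    case False
    then have "z /\<^sub>R norm z \<in> ?K"
      using that U(1) by (auto intro: subspace_scale)
    then have "(z /\<^sub>R norm z) \<bullet> T (z /\<^sub>R norm z) \<le> c"
      unfolding c_def by (rule max)
    then show ?thesis
      using False by (simp add: q_def T.scaleR field_simps power2_norm_eq_inner flip: power2_eq_square)
  qed (simp add: q_def T.zero)
  have xU: "x \<in> U" and xx: "x \<bullet> x = 1"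
    using x by (auto simp: dot_square_norm)
  define w where "w = c *\<^sub>R x - T x"
  have wU: "w \<in> U"
    unfolding w_def using xU U by (auto intro!: subspace_diff subspace_scale)
  have expand: "q (x + t *\<^sub>R w) = 2 * t * (w \<bullet> w) + t\<^sup>2 * q w" for t
  proof -
    have 1: "x \<bullet> T w = w \<bullet> T x" using sa[of x w] by (simp add: inner_commute)
    have "q (x + t *\<^sub>R w) = q x + 2 * t * (w \<bullet> (c *\<^sub>R x - T x)) + t\<^sup>2 * q w"
      unfolding q_def T.add T.scaleR inner_add_left inner_add_right inner_diff_right
        inner_scaleR_left inner_scaleR_right 1 inner_commute[of x w]
      by (simp add: field_simps power2_eq_square)
    also have "q x = 0" by (simp add: q_def xx c_def)
    finally show ?thesis unfolding w_def[symmetric] by simp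
  qed
  have "w \<bullet> w = 0"
  proof (rule ccontr)
    assume "w \<bullet> w \<noteq> 0"
    define a b where "a = w \<bullet> w" and "b = q w"
    have a: "a > 0" using \<open>w \<bullet> w \<noteq> 0\<close> by (simp add: a_def)
    have b: "b \<ge> 0" unfolding b_def by (rule q_nonneg) fact
    \<comment> \<open>The step \<open>- s\<close> makes the linear term of \<open>expand\<close>
      outweigh the quadratic one; the \<open>+ 1\<close> keeps the denominator positive when
      \<open>b = 0\<close>.\<close>
    define s where "s = a / (b + 1)"
    have s: "s > 0" "a = s * (b + 1)" using a b by (auto simp: s_def)
    have "0 \<le> 2 * (- s) * a + (- s)\<^sup>2 * b"
      using q_nonneg[of "x + (- s) *\<^sub>R w"] expand[of "- s"] xU wU U(1)
      unfolding a_def b_def by (metis subspace_add subspace_scale)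
    also have "\<dots> = - (s\<^sup>2 * (b + 2))"
      unfolding s(2) by (simp add: power2_eq_square algebra_simps)
    also have "\<dots> < 0" using s(1) b by simp
    finally show False by simp
  qed
  then have "T x = c *\<^sub>R x" by (simp add: w_def)
  then show ?thesis using x by auto
qed

text \<open>Eigenvectors are split off one by one: self-adjointness keeps the orthogonal complement
  of those found invariant, and it is nonzero while their number is below the dimension.\<close>

lemma selfadjoint_orthonormal_eigenbasis:
  fixes T :: "'a::euclidean_space \<Rightarrow> 'a"
  assumes T: "linear T" and sa: "\<And>x y. T x \<bullet> y = x \<bullet> T y"
  obtains B c where "finite B" "pairwise orthogonal B" "\<And>b. b \<in> B \<Longrightarrow> norm b = 1"
    "span B = UNIV" "\<And>b. b \<in> B \<Longrightarrow> T b = c b *\<^sub>R b"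
proof -
  interpret T: linear T by fact
  let ?P = "\<lambda>B. finite B \<and> pairwise orthogonal B \<and> (\<forall>b\<in>B. norm b = 1 \<and> (\<exists>c. T b = c *\<^sub>R b))"
  have indep: "independent B" if "?P B" for B
    using that by (intro pairwise_orthogonal_independent) auto
  have "\<exists>B. ?P B \<and> card B = n" if "n \<le> DIM('a)" for n
    using that
  proof (induction n)
    case 0
    then show ?case by (intro exI[of _ "{}"]) auto
  next
    case (Suc n)
    then obtain B where B: "?P B" "card B = n" by auto
    define U where "U = B\<^sup>\<bottom>"
    have U: "subspace U" unfolding U_def by (rule subspace_orthogonal_comp)
    have "T ` U \<subseteq> U"
      using B(1) by (fastforce simp: U_def orthogonal_comp_def orthogonal_def sa[symmetric])
    moreover have "U \<noteq> {0}"
    proof -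
      have "dim B < DIM('a)"
        using indep[OF B(1)] B(2) Suc.prems by (simp add: dim_eq_card_independent)
      then obtain x where "x \<noteq> 0" "\<And>y. y \<in> span B \<Longrightarrow> orthogonal x y"
        using orthogonal_to_subspace_exists[of B] by auto
      then have "x \<in> U"
        by (auto simp: U_def orthogonal_comp_def orthogonal_commute span_base)
      then show ?thesis using \<open>x \<noteq> 0\<close> by auto
    qed
    ultimately obtain x d where x: "x \<in> U" "norm x = 1" "T x = d *\<^sub>R x"
      using selfadjoint_eigenvector[OF T sa U] by blast
    have "x \<notin> B"
      using x by (auto simp: U_def orthogonal_comp_def orthogonal_def)
    moreover have "pairwise orthogonal (insert x B)"
      using B(1) x(1)
      by (auto simp: pairwise_insert U_def orthogonal_comp_def orthogonal_commute)
    ultimately show ?case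
      using B x by (intro exI[of _ "insert x B"]) auto
  qed
  then obtain B where B: "?P B" "card B = DIM('a)" by blast
  then obtain c where "\<forall>b\<in>B. T b = c b *\<^sub>R b" by metis
  moreover have "span B = UNIV"
    using indep[OF B(1)] B(2) by (metis dim_eq_card_independent dim_eq_full)
  ultimately show ?thesis using that B(1) by blast
qed

section \<open>Square roots of positive definite matrices\<close>

lemma inner_matrix_vector_mult:
  fixes A :: "real ^ 'n ^ 'm"
  shows "x \<bullet> (A *v y) = (transpose A *v x) \<bullet> y"
  by (simp add: dot_lmul_matrix transpose_matrix_vector)

lemma positive_definite_selfadjoint:
  "positive_definite C \<Longrightarrow> (C *v x) \<bullet> y = x \<bullet> (C *v y)"
  by (simp add: positive_definite_def inner_matrix_vector_mult)

lemma positive_definiteI: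
  fixes C :: "real ^ 'n ^ 'n"
  assumes "\<And>x y. (C *v x) \<bullet> y = x \<bullet> (C *v y)" "\<And>x. x \<noteq> 0 \<Longrightarrow> x \<bullet> (C *v x) > 0"
  shows "positive_definite C"
proof -
  have "transpose C *v x = C *v x" for x
    by (rule vector_eq_ldot[THEN iffD1]) (metis assms(1) inner_commute inner_matrix_vector_mult)
  then show ?thesis
    using assms(2) by (simp add: positive_definite_def matrix_eq)
qed

text \<open>Taking roots of the eigenvalues on an orthonormal eigenbasis gives \<open>R\<close>;
  then \<open>R ** R\<close> and \<open>C\<close> agree on the basis, hence everywhere.\<close>

lemma positive_definite_sqrt_exists:
  fixes C :: "real ^ 'n ^ 'n"
  assumes C: "positive_definite C"
  shows "\<exists>R. positive_definite R \<and> R ** R = C"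
proof -
  obtain B c where B: "finite B" "pairwise orthogonal B" "\<And>b. b \<in> B \<Longrightarrow> norm b = 1"
    "span B = UNIV" and c: "\<And>b. b \<in> B \<Longrightarrow> C *v b = c b *\<^sub>R b"
    using selfadjoint_orthonormal_eigenbasis[of "(*v) C"]
      positive_definite_selfadjoint[OF C] matrix_vector_mul_linear by metis
  have cpos: "c b > 0" if "b \<in> B" for b
  proof -
    have "b \<noteq> 0" using B(3)[OF that] by auto
    then have "b \<bullet> (C *v b) > 0" using C by (simp add: positive_definite_def)
    then show ?thesis using c[OF that] B(3)[OF that] by (simp add: dot_square_norm)
  qed
  define F where "F x = (\<Sum>b\<in>B. (sqrt (c b) * (b \<bullet> x)) *\<^sub>R b)" for x
  define R where "R = matrix F"
  have "linear F"
    unfolding F_def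
    by (intro linear_compose_sum ballI linearI) (simp_all add: inner_add_right algebra_simps)
  then have R: "R *v x = F x" for x by (simp add: R_def)
  have Rb: "R *v b = sqrt (c b) *\<^sub>R b" if "b \<in> B" for b
  proof -
    have "(sqrt (c a) * (a \<bullet> b)) *\<^sub>R a = (if a = b then sqrt (c b) *\<^sub>R b else 0)" if "a \<in> B" for a
      using B(2,3) that \<open>b \<in> B\<close> by (auto simp: pairwise_def orthogonal_def dot_square_norm)
    then show ?thesis using B(1) that by (simp add: R F_def sum.delta)
  qed
  have "positive_definite R"
  proof (rule positive_definiteI)
    show "(R *v x) \<bullet> y = x \<bullet> (R *v y)" for x y
      by (auto simp: R F_def inner_sum_left inner_sum_right inner_commute intro!: sum.cong)
  next
    fix x :: "real ^ 'n" assume "x \<noteq> 0"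
    \<comment> \<open>A vector orthogonal to a spanning set would be orthogonal to itself.\<close>
    have "\<exists>b\<in>B. b \<bullet> x \<noteq> 0"
    proof (rule ccontr)
      assume "\<not> ?thesis"
      then have "orthogonal x x"
        using orthogonal_to_span[of x B x] B(4) by (auto simp: orthogonal_def inner_commute)
      then show False using \<open>x \<noteq> 0\<close> by (simp add: orthogonal_def)
    qed
    then obtain b where b: "b \<in> B" "b \<bullet> x \<noteq> 0" by auto
    have "0 < (\<Sum>b\<in>B. sqrt (c b) * (b \<bullet> x)\<^sup>2)"
      using B(1) b cpos by (intro sum_pos2[of _ b]) (auto simp: less_imp_le)
    also have "\<dots> = x \<bullet> (R *v x)"
      by (auto simp: R F_def inner_sum_right inner_commute power2_eq_square intro!: sum.cong)
    finally show "x \<bullet> (R *v x) > 0" .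
  qed
  moreover have "R ** R = C"
  proof -
    have "(R ** R) *v x = C *v x" for x
    proof (rule linear_eq_on[of "(*v) (R ** R)" "(*v) C" x B])
      show "(R ** R) *v b = C *v b" if "b \<in> B" for b
        using Rb[OF that] c[OF that] cpos[OF that]
        by (simp add: matrix_vector_mul_assoc[symmetric] matrix_vector_mult_scaleR)
    qed (auto simp: B(4) matrix_vector_mul_linear)
    then show ?thesis by (simp add: matrix_eq)
  qed
  ultimately show ?thesis by blast
qed

text \<open>
  If \<open>D = R - Q\<close> then \<open>R D + D Q = 0\<close>; an eigenvector \<open>x\<close> of the symmetric \<open>D\<close> with eigenvalue
  \<open>d\<close> gives \<open>d (x \<bullet> R x + x \<bullet> Q x) = 0\<close>, so \<open>d = 0\<close>.
\<close>

lemma positive_definite_sqrt_unique: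
  fixes R Q :: "real ^ 'n ^ 'n"
  assumes R: "positive_definite R" and Q: "positive_definite Q" and eq: "R ** R = Q ** Q"
  shows "R = Q"
proof -
  define D where "D = R - Q"
  have sa: "(D *v x) \<bullet> y = x \<bullet> (D *v y)" for x y
    by (simp add: D_def matrix_vector_mult_diff_rdistrib inner_diff
        positive_definite_selfadjoint[OF R] positive_definite_selfadjoint[OF Q])
  have comm: "R *v (D *v x) + D *v (Q *v x) = 0" for x
    using arg_cong[OF eq, of "\<lambda>A. A *v x"]
    by (simp add: D_def matrix_vector_mult_diff_rdistrib matrix_vector_mult_diff_distrib
        matrix_vector_mul_assoc[symmetric])
  obtain B c where B: "finite B" "pairwise orthogonal B" "\<And>b. b \<in> B \<Longrightarrow> norm b = 1"
    "span B = UNIV" and c: "\<And>b. b \<in> B \<Longrightarrow> D *v b = c b *\<^sub>R b"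
    using selfadjoint_orthonormal_eigenbasis[of "(*v) D"] sa matrix_vector_mul_linear by metis
  have "D *v b = 0" if b: "b \<in> B" for b
  proof -
    have "b \<noteq> 0" using B(3)[OF b] by auto
    then have pos: "b \<bullet> (R *v b) + b \<bullet> (Q *v b) > 0"
      using R Q by (simp add: positive_definite_def add_pos_pos)
    have "0 = b \<bullet> (R *v (D *v b) + D *v (Q *v b))" by (simp add: comm)
    also have "\<dots> = c b * (b \<bullet> (R *v b) + b \<bullet> (Q *v b))"
      by (simp add: inner_add_right sa[symmetric] c[OF b] matrix_vector_mult_scaleR algebra_simps)
    finally show ?thesis using pos c[OF b] by simp
  qed
  then have "D *v x = 0 *v x" for x
    by (intro linear_eq_on[of "(*v) D" "(*v) 0" x B])
      (auto simp: B(4) matrix_vector_mul_linear)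
  then have "D = 0" by (metis matrix_eq)
  then show ?thesis by (simp add: D_def)
qed

lemma matrix_sqrt:
  assumes "positive_definite C"
  shows "positive_definite (matrix_sqrt C)" "matrix_sqrt C ** matrix_sqrt C = C"
proof -
  have "\<exists>!R. positive_definite R \<and> R ** R = C"
    using positive_definite_sqrt_exists[OF assms] positive_definite_sqrt_unique by blast
  then have "positive_definite (matrix_sqrt C) \<and> matrix_sqrt C ** matrix_sqrt C = C"
    unfolding matrix_sqrt_def by (rule theI')
  then show "positive_definite (matrix_sqrt C)" "matrix_sqrt C ** matrix_sqrt C = C" by auto
qed

lemma positive_definite_inverse:
  fixes C :: "real ^ 'n ^ 'n"
  assumes "positive_definite C"
  shows "C *v (matrix_inv C *v x) = x"
proof -
  have "C *v x = 0 \<Longrightarrow> x = 0" for x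
    using assms unfolding positive_definite_def by force
  then have "invertible C"
    by (metis invertible_left_inverse matrix_left_invertible_ker)
  then have "C ** matrix_inv C = mat 1"
    unfolding invertible_def matrix_inv_def by (rule someI2_ex) blast
  then show ?thesis
    by (simp add: matrix_vector_mul_assoc)
qed

section \<open>Orthogonal projections\<close>

text \<open>The definition selects by \<open>THE\<close>, so uniqueness has to be shown too: the
  difference of two candidates lies in \<open>U\<close> and is orthogonal to
  \<open>U\<close>.\<close>

lemma orth_proj:
  assumes U: "subspace U"
  shows "orth_proj U x \<in> U" "z \<in> U \<Longrightarrow> orthogonal (x - orth_proj U x) z"
proof -
  obtain y r where yz: "y \<in> span U" "\<And>w. w \<in> span U \<Longrightarrow> orthogonal r w" "x = y + r"
    using orthogonal_subspace_decomp_exists[of U x] by metis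
  have sp: "span U = U" using U by (simp add: span_eq_iff)
  have "\<exists>!y. y \<in> U \<and> (\<forall>z\<in>U. orthogonal (x - y) z)"
  proof (rule ex1I[of _ y])
    show "y \<in> U \<and> (\<forall>z\<in>U. orthogonal (x - y) z)" using yz sp by auto
  next
    fix y' assume y': "y' \<in> U \<and> (\<forall>z\<in>U. orthogonal (x - y') z)"
    have "y - y' \<in> U" using y' yz(1) sp U by (auto intro: subspace_diff)
    then have "(x - y') \<bullet> (y - y') = 0" "(x - y) \<bullet> (y - y') = 0"
      using y' yz sp by (auto simp: orthogonal_def)
    then have "(y - y') \<bullet> (y - y') = 0" by (simp add: inner_diff)
    then show "y' = y" by simp
  qed
  then have "orth_proj U x \<in> U \<and> (\<forall>z\<in>U. orthogonal (x - orth_proj U x) z)"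
    unfolding orth_proj_def by (rule theI')
  then show "orth_proj U x \<in> U" "z \<in> U \<Longrightarrow> orthogonal (x - orth_proj U x) z" by auto
qed

lemma norm_orth_proj_residual_le:
  assumes U: "subspace U"
  shows "norm (x - orth_proj U x) \<le> norm x"
proof -
  have "orthogonal (x - orth_proj U x) (orth_proj U x)"
    using orth_proj[OF U] by blast
  then have "(norm (x - orth_proj U x + orth_proj U x))\<^sup>2 =
      (norm (x - orth_proj U x))\<^sup>2 + (norm (orth_proj U x))\<^sup>2"
    by (rule norm_add_Pythagorean)
  then show ?thesis by (simp add: power2_le_imp_le)
qed

section \<open>Patterns and subdifferentials\<close>

lemma pattern_subset: "pattern S v x \<subseteq> S"
  by (auto simp: pattern_def)

text \<open>The condition becomes a system of linear equations, which is what exhibits the pattern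
  space as a concrete subspace.\<close>

lemma pattern_eq_self_iff:
  "pattern I v u = I \<longleftrightarrow> (\<forall>i\<in>I. \<forall>j\<in>I. v i \<bullet> u = v j \<bullet> u)"
proof
  assume eq: "pattern I v u = I"
  show "\<forall>i\<in>I. \<forall>j\<in>I. v i \<bullet> u = v j \<bullet> u"
  proof (intro ballI order_antisym)
    fix i j assume "i \<in> I" "j \<in> I"
    then have "i \<in> pattern I v u" "j \<in> pattern I v u" using eq by auto
    then show "v i \<bullet> u \<le> v j \<bullet> u" "v j \<bullet> u \<le> v i \<bullet> u"
      by (auto simp: pattern_def)
  qed
next
  assume "\<forall>i\<in>I. \<forall>j\<in>I. v i \<bullet> u = v j \<bullet> u"
  then have "v j \<bullet> u \<le> v i \<bullet> u" if "i \<in> I" "j \<in> I" for i j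
    using that by (metis order_refl)
  then show "pattern I v u = I" by (auto simp: pattern_def)
qed

lemma pattern_scaleR: "t > 0 \<Longrightarrow> pattern S v (t *\<^sub>R x) = pattern S v x"
  by (simp add: pattern_def)

lemma Max_pattern:
  "finite S \<Longrightarrow> i \<in> pattern S v x \<Longrightarrow> Max ((\<lambda>i. v i \<bullet> x) ` S) = v i \<bullet> x"
  by (intro Max_eqI) (auto simp: pattern_def)

lemma pattern_nonempty:
  assumes "finite S" "S \<noteq> {}"
  shows "pattern S v x \<noteq> {}"
proof -
  have "Max ((\<lambda>i. v i \<bullet> x) ` S) \<in> (\<lambda>i. v i \<bullet> x) ` S"
    using assms by simp
  then obtain i where "i \<in> S" "Max ((\<lambda>i. v i \<bullet> x) ` S) = v i \<bullet> x" by auto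
  then have "i \<in> pattern S v x"
    using assms by (auto simp: pattern_def Max_ge_iff intro: Max_ge[of "(\<lambda>i. v i \<bullet> x) ` S"] dest: sym)
  then show ?thesis by blast
qed

text \<open>Indices outside the pattern of \<open>x\<close> lose by strict inequalities, finitely
  many of which survive a common small perturbation; the active ones tie at \<open>x\<close>, so
  \<open>y\<close> alone decides among them.\<close>

lemma pattern_add_local:
  assumes "finite S" "S \<noteq> {}"
  obtains d where "d > 0"
    "\<And>y. norm y < d \<Longrightarrow> pattern S v (x + y) = pattern (pattern S v x) v y"
proof -
  let ?I = "pattern S v x"
  obtain k where k: "k \<in> ?I" using pattern_nonempty[OF assms] by blast
  have "\<forall>\<^sub>F y in nhds 0. \<forall>i\<in>S - ?I. v i \<bullet> (x + y) < v k \<bullet> (x + y)"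
  proof (intro eventually_ball_finite ballI)
    fix i assume i: "i \<in> S - ?I"
    have lt: "v i \<bullet> (x + 0) < v k \<bullet> (x + 0)"
    proof (rule ccontr)
      assume "\<not> ?thesis"
      then have "i \<in> ?I" using i k by (force simp: pattern_def)
      then show False using i by blast
    qed
    have lim: "((\<lambda>y. v k \<bullet> (x + y) - v i \<bullet> (x + y)) \<longlongrightarrow> v k \<bullet> (x + 0) - v i \<bullet> (x + 0)) (nhds 0)"
      by (intro tendsto_intros filterlim_ident)
    have "\<forall>\<^sub>F y in nhds 0. 0 < v k \<bullet> (x + y) - v i \<bullet> (x + y)"
      by (rule order_tendstoD(1)[OF lim]) (use lt in simp)
    then show "\<forall>\<^sub>F y in nhds 0. v i \<bullet> (x + y) < v k \<bullet> (x + y)" by simp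
  qed (use assms in auto)
  then obtain d where d: "d > 0"
    "\<And>y i. norm y < d \<Longrightarrow> i \<in> S - ?I \<Longrightarrow> v i \<bullet> (x + y) < v k \<bullet> (x + y)"
    unfolding eventually_nhds_metric by auto
  have "pattern S v (x + y) = pattern ?I v y" if y: "norm y < d" for y
  proof (intro set_eqI iffI)
    fix i assume i: "i \<in> pattern S v (x + y)"
    then have iS: "i \<in> S" and ge: "\<And>j. j \<in> S \<Longrightarrow> v j \<bullet> (x + y) \<le> v i \<bullet> (x + y)"
      by (auto simp: pattern_def)
    have iI: "i \<in> ?I"
      using d(2)[OF y, of i] ge[of k] k iS by (force simp: pattern_def)
    have "v j \<bullet> y \<le> v i \<bullet> y" if "j \<in> ?I" for j
      using ge[of j] that iI by (force simp: pattern_def inner_add_right)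
    then show "i \<in> pattern ?I v y" using iI by (simp add: pattern_def[of ?I])
  next
    fix i assume "i \<in> pattern ?I v y"
    then have iI: "i \<in> ?I" and ge: "\<And>j. j \<in> ?I \<Longrightarrow> v j \<bullet> y \<le> v i \<bullet> y"
      by (auto simp: pattern_def[of ?I])
    have ge': "v j \<bullet> (x + y) \<le> v i \<bullet> (x + y)" if "j \<in> ?I" for j
      using ge[OF that] iI that by (auto simp: pattern_def inner_add_right intro: add_mono)
    have "v j \<bullet> (x + y) \<le> v i \<bullet> (x + y)" if "j \<in> S" for j
      using ge'[of j] ge'[OF k] d(2)[OF y, of j] that by (cases "j \<in> ?I") auto
    then show "i \<in> pattern S v (x + y)" using iI by (auto simp: pattern_def)
  qed
  then show ?thesis using that d(1) by blast
qed

lemma pattern_add_scaleR_eventually: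
  assumes "finite S" "S \<noteq> {}"
  shows "\<forall>\<^sub>F t in at_right 0. pattern S v (x + t *\<^sub>R u) = pattern (pattern S v x) v u"
proof -
  obtain d where d: "d > 0"
    "\<And>y. norm y < d \<Longrightarrow> pattern S v (x + y) = pattern (pattern S v x) v y"
    using pattern_add_local[OF assms, of v x] by blast
  have "((\<lambda>t. norm (t *\<^sub>R u)) \<longlongrightarrow> norm (0 *\<^sub>R u)) (at_right 0)"
    by (intro tendsto_intros)
  then have "\<forall>\<^sub>F t in at_right 0. norm (t *\<^sub>R u) < d"
    by (rule order_tendstoD) (use d in simp)
  moreover have "\<forall>\<^sub>F t in at_right (0::real). t > 0"
    by (rule eventually_at_right_less)
  ultimately show ?thesis
    by eventually_elim (simp add: d(2) pattern_scaleR)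
qed

text \<open>The right-hand side is a subspace containing the generators of the span. Conversely, for
  \<open>u\<close> in it, \<open>x + t u\<close> keeps the pattern of \<open>x\<close> for small
  \<open>t > 0\<close>, so \<open>u\<close> is a multiple of a difference of two generators.\<close>

lemma pattern_space_eq:
  assumes "finite S" "S \<noteq> {}"
  shows "pattern_space S v x = {u. pattern (pattern S v x) v u = pattern S v x}" (is "_ = ?U")
proof
  have "subspace ?U"
  proof (rule subspaceI)
    fix y z c assume "y \<in> ?U" "z \<in> ?U"
    then have eq: "v i \<bullet> y = v j \<bullet> y" "v i \<bullet> z = v j \<bullet> z"
      if "i \<in> pattern S v x" "j \<in> pattern S v x" for i j
      using that unfolding pattern_eq_self_iff by blast+
    show "y + z \<in> ?U" "c *\<^sub>R y \<in> ?U"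
      unfolding mem_Collect_eq pattern_eq_self_iff inner_add_right inner_scaleR_right
      by (intro ballI arg_cong2[where f = "(+)"] arg_cong2[where f = "(*)"] eq refl; assumption)+
  qed (simp add: pattern_eq_self_iff)
  moreover have "{u. pattern S v u = pattern S v x} \<subseteq> ?U"
  proof clarify
    fix u assume eq: "pattern S v u = pattern S v x"
    have "pattern (pattern S v u) v u = pattern S v u"
      by (auto simp: pattern_def)
    then show "pattern (pattern S v x) v u = pattern S v x" by (simp only: eq)
  qed
  ultimately show "pattern_space S v x \<subseteq> ?U"
    unfolding pattern_space_def by (rule span_minimal[rotated])
next
  show "?U \<subseteq> pattern_space S v x"
  proof
    fix u assume u: "u \<in> ?U"
    have "\<forall>\<^sub>F t in at_right (0::real). t > 0 \<and> pattern S v (x + t *\<^sub>R u) = pattern S v x"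
      using pattern_add_scaleR_eventually[OF assms, of v x u] u
      by (simp add: eventually_conj_iff eventually_at_right_less)
    then obtain t where t: "t > 0" "pattern S v (x + t *\<^sub>R u) = pattern S v x"
      using eventually_happens'[of "at_right (0::real)"] by auto
    then have "x + t *\<^sub>R u \<in> pattern_space S v x" "x \<in> pattern_space S v x"
      by (auto simp: pattern_space_def intro: span_base)
    then have "(1 / t) *\<^sub>R ((x + t *\<^sub>R u) - x) \<in> pattern_space S v x"
      unfolding pattern_space_def by (intro span_scale span_diff)
    then show "u \<in> pattern_space S v x" using t(1) by simp
  qed
qed

section \<open>Directional derivatives and subdifferentials of max-linear penalties\<close>

lemma directional_limit:
  assumes "GDERIV g x :> D"
  shows "((\<lambda>t. (g (x + t *\<^sub>R u) - g x) / t) \<longlongrightarrow> u \<bullet> D) (at_right 0)"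
proof -
  have "((\<lambda>t::real. g (x + t *\<^sub>R u)) has_derivative (\<lambda>t. (t *\<^sub>R u) \<bullet> D)) (at 0)"
    by (rule has_derivative_compose[of "\<lambda>t. x + t *\<^sub>R u" "\<lambda>t. t *\<^sub>R u"])
      (use assms in \<open>auto simp: gderiv_def intro!: derivative_eq_intros\<close>)
  then have "((\<lambda>t. g (x + t *\<^sub>R u)) has_field_derivative (u \<bullet> D)) (at 0)"
    by (simp add: has_field_derivative_def mult_commute_abs)
  then have "((\<lambda>t. g (x + t *\<^sub>R u)) has_field_derivative (u \<bullet> D)) (at_right 0)"
    by (rule has_field_derivative_at_within)
  then show ?thesis by (simp add: has_field_derivative_iff)
qed

text \<open>Convexity bounds the difference quotients along the segment to \<open>y\<close> by
  \<open>g y - g x\<close>; letting \<open>t\<close> tend to 0 gives the tangent inequality.\<close>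

lemma convex_on_gradient_ineq:
  fixes g :: "'a::real_inner \<Rightarrow> real"
  assumes "convex_on UNIV g" "GDERIV g x :> D"
  shows "g y \<ge> g x + D \<bullet> (y - x)"
proof -
  have "\<forall>\<^sub>F t in at_right 0. (g (x + t *\<^sub>R (y - x)) - g x) / t \<le> g y - g x"
    unfolding eventually_at_right_field
  proof (intro exI[of _ 1] conjI allI impI)
    fix t :: real assume t: "0 < t" "t < 1"
    have "x + t *\<^sub>R (y - x) = (1 - t) *\<^sub>R x + t *\<^sub>R y" by (simp add: algebra_simps)
    then have "g (x + t *\<^sub>R (y - x)) \<le> (1 - t) * g x + t * g y"
      using convex_onD[OF assms(1), of t x y] t by simp
    then show "(g (x + t *\<^sub>R (y - x)) - g x) / t \<le> g y - g x"
      using t by (simp add: field_simps)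
  qed simp
  then have "(y - x) \<bullet> D \<le> g y - g x"
    by (intro tendsto_upperbound[OF directional_limit[OF assms(2)]]) auto
  then show ?thesis by (simp add: inner_commute)
qed

text \<open>For small \<open>t > 0\<close> the index \<open>i\<close> attains the maximum both at
  \<open>x\<close> and at \<open>x + t u\<close>, so the quotient is exactly
  \<open>v i \<bullet> u\<close> plus the quotient of \<open>g\<close>.\<close>

lemma max_linear_directional_limit:
  fixes f :: "real ^ 'p \<Rightarrow> real"
  assumes f: "max_linear_form f S v g" and D: "GDERIV g x :> D"
    and i: "i \<in> pattern (pattern S v x) v u"
  shows "((\<lambda>t. (f (x + t *\<^sub>R u) - f x) / t) \<longlongrightarrow> v i \<bullet> u + D \<bullet> u) (at_right 0)"
proof -
  have S: "finite S" "S \<noteq> {}" and fx: "\<And>x. f x = Max ((\<lambda>i. v i \<bullet> x) ` S) + g x"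
    using f by (auto simp: max_linear_form_def)
  have "\<forall>\<^sub>F t in at_right (0::real). t > 0"
    by (rule eventually_at_right_less)
  with pattern_add_scaleR_eventually[OF S, of v x u] have "\<forall>\<^sub>F t in at_right 0.
      v i \<bullet> u + (g (x + t *\<^sub>R u) - g x) / t = (f (x + t *\<^sub>R u) - f x) / t"
  proof eventually_elim
    case (elim t)
    then have "i \<in> pattern S v (x + t *\<^sub>R u)" using i by simp
    moreover have "i \<in> pattern S v x" using i pattern_subset[of "pattern S v x" v u] by blast
    ultimately have "f (x + t *\<^sub>R u) = v i \<bullet> (x + t *\<^sub>R u) + g (x + t *\<^sub>R u)"
      "f x = v i \<bullet> x + g x"
      by (simp_all only: fx Max_pattern[OF S(1)])
    then show ?case
      using elim(2) by (simp add: inner_add_right field_simps)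
  qed
  moreover have "((\<lambda>t. v i \<bullet> u + (g (x + t *\<^sub>R u) - g x) / t) \<longlongrightarrow> v i \<bullet> u + D \<bullet> u) (at_right 0)"
    using directional_limit[OF D, of u] by (intro tendsto_add tendsto_const) (simp add: inner_commute)
  ultimately show ?thesis by (rule Lim_transform_eventually[rotated])
qed

lemma max_linear_dir_deriv:
  assumes "max_linear_form f S v g" "GDERIV g x :> D" "i \<in> pattern (pattern S v x) v u"
  shows "dir_deriv f x u = v i \<bullet> u + D \<bullet> u"
  unfolding dir_deriv_def
  by (rule tendsto_Lim[OF _ max_linear_directional_limit[OF assms]]) simp

lemma max_linear_form_gradient:
  assumes "max_linear_form f S v g"
  obtains D where "GDERIV g x :> D"
  using assms by (auto simp: max_linear_form_def continuously_differentiable_def)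

text \<open>The subgradient inequality at \<open>x + t u\<close>, divided by \<open>t\<close>,
  passes to the limit.\<close>

lemma subdifferential_le_dir_deriv:
  assumes f: "max_linear_form f S v g" and w: "w \<in> subdifferential f x"
  shows "w \<bullet> u \<le> dir_deriv f x u"
proof -
  obtain D where D: "GDERIV g x :> D" using max_linear_form_gradient[OF f] by blast
  have "finite (pattern S v x)" "pattern S v x \<noteq> {}"
    using f pattern_nonempty[of S] finite_subset[OF pattern_subset[of S v x]]
    by (simp_all add: max_linear_form_def)
  then obtain i where i: "i \<in> pattern (pattern S v x) v u"
    using pattern_nonempty by blast
  have ev: "\<forall>\<^sub>F t in at_right 0. w \<bullet> u \<le> (f (x + t *\<^sub>R u) - f x) / t"
    unfolding eventually_at_right_field
  proof (intro exI[of _ 1] conjI allI impI)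
    fix t :: real assume t: "0 < t" "t < 1"
    have "f x + w \<bullet> (x + t *\<^sub>R u - x) \<le> f (x + t *\<^sub>R u)"
      using w unfolding subdifferential_def by blast
    then show "w \<bullet> u \<le> (f (x + t *\<^sub>R u) - f x) / t"
      using t by (simp add: field_simps)
  qed simp
  have "w \<bullet> u \<le> v i \<bullet> u + D \<bullet> u"
    by (rule tendsto_lowerbound[OF max_linear_directional_limit[OF f D i] ev]) simp
  then show ?thesis by (simp add: max_linear_dir_deriv[OF f D i])
qed

text \<open>An index active at \<open>x\<close> is maximal among the active ones in both directions
  \<open>u\<close> and \<open>- u\<close>, so the derivative is odd here. The upper bounds on
  \<open>w \<bullet> u\<close> and on \<open>w \<bullet> (- u)\<close> then combine to an
  equality.\<close>

lemma dir_deriv_pattern_space: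
  assumes f: "max_linear_form f S v g" and w: "w \<in> subdifferential f x"
    and u: "u \<in> pattern_space S v x"
  shows "dir_deriv f x u = w \<bullet> u"
proof -
  obtain D where D: "GDERIV g x :> D" using max_linear_form_gradient[OF f] by blast
  have S: "finite S" "S \<noteq> {}" using f by (auto simp: max_linear_form_def)
  obtain i where i: "i \<in> pattern S v x" using pattern_nonempty[OF S] by blast
  have "- u \<in> pattern_space S v x" using u by (simp add: pattern_space_def span_neg)
  then have "i \<in> pattern (pattern S v x) v u" "i \<in> pattern (pattern S v x) v (- u)"
    using u i by (auto simp: pattern_space_eq[OF S])
  then have "dir_deriv f x (- u) = - dir_deriv f x u"
    by (simp add: max_linear_dir_deriv[OF f D])
  then show ?thesis
    using subdifferential_le_dir_deriv[OF f w, of u] subdifferential_le_dir_deriv[OF f w, of "- u"]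
    by simp
qed

text \<open>One linear piece lies below the maximum, and \<open>g\<close> lies above its tangent.
  Differences of these subgradients supply directions of the affine hull.\<close>

lemma active_gradient_in_subdifferential:
  assumes f: "max_linear_form f S v g" and D: "GDERIV g x :> D" and i: "i \<in> pattern S v x"
  shows "v i + D \<in> subdifferential f x"
proof -
  have S: "finite S" and fx: "\<And>x. f x = Max ((\<lambda>i. v i \<bullet> x) ` S) + g x"
    and g: "convex_on UNIV g"
    using f by (auto simp: max_linear_form_def)
  have "f x + (v i + D) \<bullet> (y - x) \<le> f y" for y
  proof -
    have "v i \<bullet> y \<le> Max ((\<lambda>i. v i \<bullet> y) ` S)"
      using S i pattern_subset[of S v x] by (intro Max_ge) auto
    then show ?thesis
      using convex_on_gradient_ineq[OF g D, of y]
      by (simp add: fx Max_pattern[OF S i] inner_add_left inner_diff_right)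
  qed
  then show ?thesis by (simp add: subdifferential_def)
qed

text \<open>Induction over the span: each step is an affine combination with coefficients
  \<open>1\<close>, \<open>c\<close> and \<open>- c\<close>.\<close>

lemma affine_hull_add_span_differences:
  assumes "a \<in> affine hull A" "z \<in> span {y - y' |y y'. y \<in> B \<and> y' \<in> B}" "B \<subseteq> A"
  shows "a + z \<in> affine hull A"
  using assms(2)
proof (induction rule: span_induct_alt)
  case base
  then show ?case using assms(1) by simp
next
  case (step c d z)
  then obtain y y' where d: "d = y - y'" "y \<in> affine hull A" "y' \<in> affine hull A"
    using assms(3) by (auto intro: hull_inc)
  have "1 *\<^sub>R (a + z) + c *\<^sub>R (y - y') \<in> affine hull A"
    using mem_affine_3_minus[OF affine_affine_hull step(2) d(2,3), of c]
    by (simp add: algebra_simps)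
  then show ?case by (simp add: d algebra_simps)
qed

text \<open>The pattern space is the orthogonal complement of the differences of active vectors.
  Whatever is orthogonal to it therefore lies in their span, which is parallel to the affine
  hull.\<close>

lemma orthogonal_pattern_space_affine_hull:
  assumes f: "max_linear_form f S v g"
    and a: "a \<in> affine hull (subdifferential f x)"
    and z: "\<And>u. u \<in> pattern_space S v x \<Longrightarrow> z \<bullet> u = 0"
  shows "a + z \<in> affine hull (subdifferential f x)"
proof -
  obtain D where D: "GDERIV g x :> D" using max_linear_form_gradient[OF f] by blast
  have S: "finite S" "S \<noteq> {}" using f by (auto simp: max_linear_form_def)
  let ?B = "(\<lambda>i. v i + D) ` pattern S v x"
  let ?V = "{y - y' |y y'. y \<in> ?B \<and> y' \<in> ?B}"
  \<comment> \<open>A subspace of a finite-dimensional space is its own double orthogonal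
    complement, so it suffices to test \<open>z\<close> against vectors orthogonal to all
    differences; these lie in the pattern space.\<close>
  have "z \<in> (span ?V)\<^sup>\<bottom>\<^sup>\<bottom>"
    unfolding orthogonal_comp_def[of "(span ?V)\<^sup>\<bottom>"]
  proof (intro CollectI ballI)
    fix u assume u: "u \<in> (span ?V)\<^sup>\<bottom>"
    have V_orth: "d \<bullet> u = 0" if "d \<in> ?V" for d
      using u span_base[OF that] unfolding orthogonal_comp_def orthogonal_def by blast
    have *: "(v i + D - (v j + D)) \<bullet> u = 0" if "i \<in> pattern S v x" "j \<in> pattern S v x" for i j
      by (rule V_orth, rule CollectI, rule exI[of _ "v i + D"], rule exI[of _ "v j + D"])
        (use that in auto)
    have "u \<in> pattern_space S v x"
      unfolding pattern_space_eq[OF S] pattern_eq_self_iff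
    proof (intro CollectI ballI)
      fix i j assume "i \<in> pattern S v x" "j \<in> pattern S v x"
      then show "v i \<bullet> u = v j \<bullet> u" using *[of i j] by (simp add: inner_diff_left)
    qed
    then show "orthogonal u z"
      using z by (simp add: orthogonal_def inner_commute)
  qed
  then have "z \<in> span ?V" by (simp add: orthogonal_comp_self)
  then show ?thesis
    by (rule affine_hull_add_span_differences[OF a])
      (use active_gradient_in_subdifferential[OF f D] in auto)
qed

section \<open>Recovery of the pattern space by the limiting minimizer\<close>

text \<open>An explicit candidate in the pattern space satisfies the optimality condition, and
  positive definiteness of \<open>C\<close> forces every minimizer to equal it. The admissible noise
  grows linearly in \<open>\<alpha>\<close>, so \<open>r\<close> can be chosen first.\<close>

lemma pattern_recovery:
  fixes C :: "real ^ 'p ^ 'p"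
  assumes f: "max_linear_form f S v g" and C: "positive_definite C"
    and irr: "matrix_sqrt C *v orth_proj ((*v) (matrix_sqrt C) ` pattern_space S v x)
        (matrix_inv (matrix_sqrt C) *v v\<^sub>0) \<in> rel_interior (subdifferential f x)"
  obtains r where "r > 0" "\<And>\<alpha> w u. \<alpha> > 0 \<Longrightarrow> norm w < r * \<alpha> \<Longrightarrow>
     is_arg_min (limit_objective C f x \<alpha> w) (\<lambda>_. True) u \<Longrightarrow> u \<in> pattern_space S v x"
proof -
  define R where "R = matrix_sqrt C"
  define Q where "Q = matrix_inv R"
  define U where "U = pattern_space S v x"
  define P where "P = orth_proj ((*v) R ` U)"
  define a where "a = R *v P (Q *v v\<^sub>0)"
  have R: "positive_definite R" and RR: "\<And>y. R *v (R *v y) = C *v y"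
    using matrix_sqrt[OF C] by (auto simp: R_def matrix_vector_mul_assoc)
  have RQ: "R *v (Q *v y) = y" for y
    unfolding Q_def by (rule positive_definite_inverse[OF R])
  have sa: "(R *v y) \<bullet> z = y \<bullet> (R *v z)" for y z by (rule positive_definite_selfadjoint[OF R])
  have U: "subspace U" by (simp add: U_def pattern_space_def)
  have RU: "subspace ((*v) R ` U)"
    by (intro linear_subspace_image matrix_vector_mul_linear U)
  have a: "a \<in> rel_interior (subdifferential f x)"
    using irr by (simp add: a_def P_def Q_def R_def U_def)
  then obtain e where e: "e > 0" "ball a e \<inter> affine hull (subdifferential f x) \<subseteq> subdifferential f x"
    and aS: "a \<in> subdifferential f x"
    by (auto simp: mem_rel_interior_ball)
  obtain K where K: "K > 0" "\<And>y. norm (R *v y) \<le> K * norm y"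
    using linear_bounded_pos[OF matrix_vector_mul_linear] by blast
  obtain L where L: "L > 0" "\<And>y. norm (Q *v y) \<le> L * norm y"
    using linear_bounded_pos[OF matrix_vector_mul_linear] by blast
  \<comment> \<open>\<open>K\<close> and \<open>L\<close> bound \<open>R\<close> and its inverse, so
    \<open>norm z\<close> is at most \<open>K * L * norm w\<close>, which this choice keeps below
    \<open>e * \<alpha>\<close>.\<close>
  define r where "r = e / (K * L)"
  have r: "r > 0" using e K L by (simp add: r_def)
  moreover have "u \<in> U"
    if \<alpha>: "\<alpha> > 0" and w: "norm w < r * \<alpha>"
      and u: "is_arg_min (limit_objective C f x \<alpha> w) (\<lambda>_. True) u" for \<alpha> w u
  proof -
    define z where "z = R *v (Q *v w - P (Q *v w))"
    have "norm z \<le> K * norm (Q *v w - P (Q *v w))" unfolding z_def by (rule K)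
    also have "\<dots> \<le> K * (L * norm w)"
      using norm_orth_proj_residual_le[OF RU, of "Q *v w"] L(2)[of w] K(1)
      by (intro mult_left_mono) (auto simp: P_def)
    also have "\<dots> < e * \<alpha>"
      using w K(1) L(1) by (simp add: r_def field_simps)
    finally have z: "norm ((1 / \<alpha>) *\<^sub>R z) < e" using \<alpha> by (simp add: field_simps)
    \<comment> \<open>Self-adjointness moves \<open>R\<close> onto \<open>y\<close>, and the
      projection residual is orthogonal to the image of \<open>U\<close> under
      \<open>R\<close>.\<close>
    have "((1 / \<alpha>) *\<^sub>R z) \<bullet> y = 0" if "y \<in> U" for y
      using orth_proj(2)[OF RU, of "R *v y" "Q *v w"] that
      by (simp add: z_def sa P_def orthogonal_def)
    then have "a + (1 / \<alpha>) *\<^sub>R z \<in> affine hull (subdifferential f x)"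
      by (intro orthogonal_pattern_space_affine_hull[OF f]) (auto simp: U_def hull_inc aS)
    then have s: "a + (1 / \<alpha>) *\<^sub>R z \<in> subdifferential f x"
      using e(2) z by (auto simp: dist_norm)
    obtain y where y: "y \<in> U" "P (Q *v w) - \<alpha> *\<^sub>R P (Q *v v\<^sub>0) = R *v y"
      using orth_proj(1)[OF RU] subspace_diff[OF RU] subspace_scale[OF RU] unfolding P_def
      by (metis (no_types, lifting) imageE)
    \<comment> \<open>\<open>y\<close> minimizes the objective over the pattern space; the residual \<open>w - C y\<close> splits into
      \<open>\<alpha> a\<close> and the noise part \<open>z\<close>, so it stays in \<open>\<alpha>\<close> times the subdifferential.\<close>
    have opt: "w - C *v y = \<alpha> *\<^sub>R (a + (1 / \<alpha>) *\<^sub>R z)"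
      using \<alpha> by (simp add: RR[symmetric] y(2)[symmetric] z_def a_def scaleR_right_distrib
          matrix_vector_mult_diff_distrib matrix_vector_mult_scaleR RQ)
    let ?V = "limit_objective C f x \<alpha> w"
    have Csa: "y \<bullet> (C *v u) = u \<bullet> (C *v y)"
      by (metis positive_definite_selfadjoint[OF C] inner_commute)
    \<comment> \<open>The subgradient gives an inequality at \<open>u\<close> and an equality at
      \<open>y\<close>. Together they bound \<open>?V u - ?V y\<close> below by half of
      \<open>(u - y) \<bullet> (C *v (u - y))\<close>, while \<open>u\<close> is a
      minimizer.\<close>
    have "(w - C *v y) \<bullet> u \<le> \<alpha> * dir_deriv f x u"
      unfolding opt using subdifferential_le_dir_deriv[OF f s, of u] \<alpha>
      by (simp only: inner_scaleR_left mult_le_cancel_left_pos)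
    moreover have "(w - C *v y) \<bullet> y = \<alpha> * dir_deriv f x y"
      unfolding opt using dir_deriv_pattern_space[OF f s, of y] y(1)
      by (simp only: inner_scaleR_left U_def)
    moreover have "?V u \<le> ?V y"
      using u by (simp add: is_arg_min_linorder)
    ultimately have "(u - y) \<bullet> (C *v (u - y)) \<le> 0"
      using Csa by (simp add: limit_objective_def matrix_vector_mult_diff_distrib inner_diff
          inner_commute[of w] inner_commute[of "C *v y"] algebra_simps)
    then have "u = y"
      using C unfolding positive_definite_def by (metis eq_iff_diff_eq_0 not_le)
    then show "u \<in> U" using y(1) by simp
  qed
  ultimately show ?thesis using that unfolding U_def by blast
qed

section \<open>Probabilistic estimates\<close>

lemma pattern_eq_borel:
  fixes v :: "'i \<Rightarrow> real ^ 'p"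
  assumes "finite S"
  shows "{x. pattern S v x = p} \<in> sets borel"
proof -
  have "{x. pattern S v x = p} =
      {x. p \<subseteq> S \<and> (\<forall>i\<in>S. i \<in> p \<longleftrightarrow> (\<forall>j\<in>S. v j \<bullet> x \<le> v i \<bullet> x))}"
    by (auto simp: pattern_def)
  also have "\<dots> \<in> sets borel"
  proof -
    have le: "{x \<in> space borel. v j \<bullet> x \<le> v i \<bullet> x} \<in> sets borel" for i j
      by measurable
    have "{x \<in> space borel. i \<in> p \<longleftrightarrow> (\<forall>j\<in>S. v j \<bullet> x \<le> v i \<bullet> x)} \<in> sets borel" for i
    proof -
      have "{x \<in> space borel. \<forall>j\<in>S. v j \<bullet> x \<le> v i \<bullet> x} \<in> sets borel"
        by (intro sets.sets_Collect_finite_All le assms)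
      then show ?thesis
        by (cases "i \<in> p") (simp_all only: simp_thms sets.sets_Collect_neg)
    qed
    then have "{x \<in> space borel. p \<subseteq> S \<and> (\<forall>i\<in>S. i \<in> p \<longleftrightarrow> (\<forall>j\<in>S. v j \<bullet> x \<le> v i \<bullet> x))} \<in> sets borel"
      by (intro sets.sets_Collect_conj sets.sets_Collect_const sets.sets_Collect_finite_All assms)
    then show ?thesis by simp
  qed
  finally show ?thesis .
qed

lemma sets_pattern_eq:
  assumes "finite S" "X \<in> borel_measurable M"
  shows "{\<omega> \<in> space M. pattern S v (X \<omega>) = p} \<in> sets M"
  using measurable_sets[OF assms(2) pattern_eq_borel[OF assms(1), of v p]]
  by (simp add: vimage_def Int_def conj_commute)

text \<open>Weak convergence is tested on a continuous function that dominates the indicator of a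
  large norm and has small expectation in the limit.\<close>

lemma converges_weakly_tight:
  fixes X :: "nat \<Rightarrow> 'a \<Rightarrow> real ^ 'p" and Y :: "'w \<Rightarrow> real ^ 'p"
  assumes conv: "converges_weakly M X N Y"
    and M: "\<And>n. prob_space (M n)" and N: "prob_space N"
    and X: "\<And>n. X n \<in> borel_measurable (M n)" and Y: "Y \<in> borel_measurable N"
    and e: "e > 0"
  obtains k where "k \<ge> 0"
    "\<forall>\<^sub>F n in sequentially. measure (M n) {\<omega> \<in> space (M n). norm (X n \<omega>) \<ge> k} < e"
proof -
  \<comment> \<open>A ramp rising from 0 at norm \<open>k\<close> to 1 at norm \<open>k + 1\<close>;
    this is why the final radius is \<open>real k + 1\<close>.\<close>
  define \<phi> where "\<phi> k x = min 1 (max 0 (norm x - real k))" for k and x :: "real ^ 'p"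
  have \<phi>: "continuous_on UNIV (\<phi> k)" "\<And>x. 0 \<le> \<phi> k x" "\<And>x. \<phi> k x \<le> 1" for k
    unfolding \<phi>_def by (auto intro!: continuous_intros)
  have \<phi>_meas: "\<phi> k \<in> borel_measurable borel" for k
    by (rule borel_measurable_continuous_onI) (rule \<phi>)
  interpret N: prob_space N by fact
  \<comment> \<open>At each \<open>\<omega>\<close> the ramp vanishes once \<open>k\<close> reaches
    the norm of \<open>Y \<omega>\<close>, so dominated convergence applies.\<close>
  have "(\<lambda>k. \<integral>\<omega>. \<phi> k (Y \<omega>) \<partial>N) \<longlonglongrightarrow> (\<integral>\<omega>. 0 \<partial>N)"
  proof (rule integral_dominated_convergence[where w = "\<lambda>_. 1"])
    show "AE \<omega> in N. (\<lambda>k. \<phi> k (Y \<omega>)) \<longlonglongrightarrow> 0"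
    proof (rule AE_I2)
      fix \<omega>
      have "\<forall>\<^sub>F k in sequentially. \<phi> k (Y \<omega>) = 0"
        using eventually_ge_at_top[of "nat \<lceil>norm (Y \<omega>)\<rceil>"]
        by eventually_elim (auto simp: \<phi>_def max_def min_def ceiling_le_iff nat_le_iff)
      then show "(\<lambda>k. \<phi> k (Y \<omega>)) \<longlonglongrightarrow> 0" by (rule tendsto_eventually)
    qed
    show "(\<lambda>\<omega>. \<phi> k (Y \<omega>)) \<in> borel_measurable N" for k
      by (rule measurable_compose[OF Y \<phi>_meas])
    show "AE \<omega> in N. norm (\<phi> k (Y \<omega>)) \<le> 1" for k using \<phi> by simp
  qed auto
  then have "\<forall>\<^sub>F k in sequentially. (\<integral>\<omega>. \<phi> k (Y \<omega>) \<partial>N) < e"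
    using e by (intro order_tendstoD) auto
  then obtain k where k: "(\<integral>\<omega>. \<phi> k (Y \<omega>) \<partial>N) < e"
    using eventually_happens'[OF sequentially_bot] by blast
  have "bounded (range (\<phi> k))"
    using \<phi>(2,3)[of k] by (intro boundedI[where B = 1]) auto
  then have "(\<lambda>n. \<integral>\<omega>. \<phi> k (X n \<omega>) \<partial>M n) \<longlonglongrightarrow> (\<integral>\<omega>. \<phi> k (Y \<omega>) \<partial>N)"
    using conv \<phi>(1) unfolding converges_weakly_def by blast
  then have "\<forall>\<^sub>F n in sequentially. (\<integral>\<omega>. \<phi> k (X n \<omega>) \<partial>M n) < e"
    using k by (rule order_tendstoD)
  then have "\<forall>\<^sub>F n in sequentially. measure (M n) {\<omega> \<in> space (M n). norm (X n \<omega>) \<ge> real k + 1} < e"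
  proof eventually_elim
    case (elim n)
    interpret M: prob_space "M n" by fact
    let ?A = "{\<omega> \<in> space (M n). norm (X n \<omega>) \<ge> real k + 1}"
    have A: "?A \<in> sets (M n)" using X[of n] by measurable
    have "measure (M n) ?A = (\<integral>\<omega>. indicator ?A \<omega> \<partial>M n)" using A by simp
    also have "\<dots> \<le> (\<integral>\<omega>. \<phi> k (X n \<omega>) \<partial>M n)"
    proof (rule integral_mono)
      show "integrable (M n) (\<lambda>\<omega>. indicator ?A \<omega> :: real)"
        using A by (intro M.integrable_const_bound[where B = 1]) (auto simp: indicator_def)
      show "integrable (M n) (\<lambda>\<omega>. \<phi> k (X n \<omega>))"
        using \<phi> by (intro M.integrable_const_bound[where B = 1] measurable_compose[OF X \<phi>_meas]) auto
      show "indicator ?A \<omega> \<le> \<phi> k (X n \<omega>)" for \<omega>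
        by (auto simp: \<phi>_def indicator_def)
    qed
    finally show ?case using elim by simp
  qed
  then show ?thesis by (intro that[of "real k + 1"]) auto
qed

text \<open>A union bound over the coordinates gives a tail with prefactor \<open>2 * p\<close>; a
  smaller rate in the exponent then restores the prefactor 2.\<close>

lemma sub_gaussian_norm_tail:
  fixes W :: "'w \<Rightarrow> real ^ 'p"
  assumes N: "prob_space N" and sg: "\<And>i. sub_gaussian N (\<lambda>\<omega>. W \<omega> $ i)"
  obtains c where "c > 0"
    "\<And>t. t \<ge> 0 \<Longrightarrow> measure N {\<omega> \<in> space N. norm (W \<omega>) \<ge> t} \<le> 2 * exp (- c * t\<^sup>2)"
proof -
  interpret N: prob_space N by fact
  have meas: "(\<lambda>\<omega>. W \<omega> $ i) \<in> borel_measurable N" for i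
    using sg[of i] by (simp add: sub_gaussian_def)
  have "\<forall>i. \<exists>K>0. \<forall>t\<ge>0. measure N {\<omega> \<in> space N. \<bar>W \<omega> $ i\<bar> \<ge> t} \<le> 2 * exp (- (t\<^sup>2 / K\<^sup>2))"
    using sg by (simp add: sub_gaussian_def)
  then have "\<exists>K. \<forall>i. K i > 0 \<and> (\<forall>t\<ge>0.
      measure N {\<omega> \<in> space N. \<bar>W \<omega> $ i\<bar> \<ge> t} \<le> 2 * exp (- (t\<^sup>2 / (K i)\<^sup>2)))"
    by (rule choice)
  then obtain K where K: "\<And>i. K i > 0"
    "\<And>i t. t \<ge> 0 \<Longrightarrow> measure N {\<omega> \<in> space N. \<bar>W \<omega> $ i\<bar> \<ge> t} \<le> 2 * exp (- (t\<^sup>2 / (K i)\<^sup>2))"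
    by blast
  define p where "p = real CARD('p)"
  have "CARD('p) \<ge> 1" by (simp add: Suc_le_eq)
  then have p: "p \<ge> 1" by (simp add: p_def)
  define L where "L = Max (range K)"
  have KL: "K i \<le> L" for i by (simp add: L_def)
  have L: "L > 0" using K(1) KL less_le_trans by blast
  \<comment> \<open>The rate produced by the coordinate threshold \<open>t / p\<close> and the
    common scale \<open>L\<close>.\<close>
  define a where "a = 1 / (p\<^sup>2 * L\<^sup>2)"
  have a: "a > 0" using p L by (simp add: a_def)
  \<comment> \<open>\<open>min 1 y \<le> y powr \<theta>\<close> for \<open>y = 2 p exp (- a t\<^sup>2)\<close>; this \<open>\<theta>\<close> brings the union bound's prefactor \<open>2 p\<close> down to \<open>2\<close>.\<close>
  define \<theta> where "\<theta> = ln 2 / ln (2 * p)"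
  have ln2p: "ln (2 * p) \<ge> ln 2" using p by simp
  have \<theta>: "0 < \<theta>" "\<theta> \<le> 1" "\<theta> * ln (2 * p) = ln 2"
    using ln2p ln_gt_zero[of "2::real"] p by (auto simp: \<theta>_def)
  have union: "measure N {\<omega> \<in> space N. norm (W \<omega>) \<ge> t} \<le> 2 * p * exp (- a * t\<^sup>2)"
    if t: "t \<ge> 0" for t
  proof -
    have "measure N {\<omega> \<in> space N. norm (W \<omega>) \<ge> t}
        \<le> measure N (\<Union>i. {\<omega> \<in> space N. \<bar>W \<omega> $ i\<bar> \<ge> t / p})"
    proof (rule N.finite_measure_mono)
      show "{\<omega> \<in> space N. norm (W \<omega>) \<ge> t} \<subseteq> (\<Union>i. {\<omega> \<in> space N. \<bar>W \<omega> $ i\<bar> \<ge> t / p})"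
      proof (rule subsetI, rule ccontr)
        fix \<omega> assume \<omega>: "\<omega> \<in> {\<omega> \<in> space N. norm (W \<omega>) \<ge> t}"
          "\<omega> \<notin> (\<Union>i. {\<omega> \<in> space N. \<bar>W \<omega> $ i\<bar> \<ge> t / p})"
        \<comment> \<open>The norm is at most the sum of the absolute coordinates, so they cannot
          all stay below \<open>t / p\<close> when the norm reaches \<open>t\<close>.\<close>
        have "norm (W \<omega>) \<le> (\<Sum>i\<in>UNIV. \<bar>W \<omega> $ i\<bar>)" by (rule norm_le_l1_cart)
        also have "\<dots> < (\<Sum>i\<in>(UNIV :: 'p set). t / p)"
          using \<omega> by (intro sum_strict_mono) (auto simp: not_le)
        also have "\<dots> = t" using p by (simp add: p_def)
        finally show False using \<omega> by simp
      qed
      show "(\<Union>i. {\<omega> \<in> space N. \<bar>W \<omega> $ i\<bar> \<ge> t / p}) \<in> sets N"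
        using meas by (intro sets.finite_UN) auto
    qed
    also have "\<dots> \<le> (\<Sum>i\<in>UNIV. measure N {\<omega> \<in> space N. \<bar>W \<omega> $ i\<bar> \<ge> t / p})"
      using meas by (intro N.finite_measure_subadditive_finite) auto
    also have "\<dots> \<le> (\<Sum>i\<in>(UNIV :: 'p set). 2 * exp (- a * t\<^sup>2))"
    proof (rule sum_mono)
      fix i :: 'p
      have "measure N {\<omega> \<in> space N. \<bar>W \<omega> $ i\<bar> \<ge> t / p} \<le> 2 * exp (- ((t / p)\<^sup>2 / (K i)\<^sup>2))"
        using t p by (intro K(2)) simp
      also have "(t / p)\<^sup>2 / L\<^sup>2 \<le> (t / p)\<^sup>2 / (K i)\<^sup>2"
        using KL[of i] K(1)[of i] by (intro divide_left_mono power_mono) (auto simp: less_imp_le)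
      then have "2 * exp (- ((t / p)\<^sup>2 / (K i)\<^sup>2)) \<le> 2 * exp (- a * t\<^sup>2)"
        by (simp add: a_def power_divide)
      finally show "measure N {\<omega> \<in> space N. \<bar>W \<omega> $ i\<bar> \<ge> t / p} \<le> 2 * exp (- a * t\<^sup>2)" .
    qed
    also have "\<dots> = 2 * p * exp (- a * t\<^sup>2)" by (simp add: p_def)
    finally show ?thesis .
  qed
  have "measure N {\<omega> \<in> space N. norm (W \<omega>) \<ge> t} \<le> 2 * exp (- (\<theta> * a) * t\<^sup>2)" if t: "t \<ge> 0" for t
  proof -
    \<comment> \<open>\<open>s\<close> is the logarithm of the union bound, and
      \<open>min 0 s\<close> that of its minimum with 1.\<close>
    define s where "s = ln (2 * p) - a * t\<^sup>2"
    have "measure N {\<omega> \<in> space N. norm (W \<omega>) \<ge> t} \<le> exp (min 0 s)"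
      using union[OF t] p N.prob_le_1 by (simp add: s_def min_def exp_diff exp_minus field_simps)
    also have "min 0 s \<le> \<theta> * s"
      using \<theta>(1,2) by (cases "s \<le> 0") (auto simp: min_def mult_le_cancel_right1)
    then have "exp (min 0 s) \<le> exp (\<theta> * s)" by simp
    also have "\<theta> * s = ln 2 - \<theta> * a * t\<^sup>2" using \<theta>(3) by (simp add: s_def algebra_simps)
    also have "exp \<dots> = 2 * exp (- (\<theta> * a) * t\<^sup>2)" by (simp add: exp_diff exp_minus field_simps)
    finally show ?thesis .
  qed
  then show ?thesis using that[of "\<theta> * a"] \<theta> a by simp
qed

section \<open>Transfer of pattern convergence to subfamilies and arbitrary index sets\<close>

lemma pattern_reindex:
  assumes "bij_betw b T S"
  shows "b ` pattern T (v \<circ> b) x = pattern S v x"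
proof -
  have S: "S = b ` T" using assms by (simp add: bij_betw_def)
  show ?thesis by (auto simp: pattern_def S)
qed

lemma max_linear_form_reindex:
  assumes f: "max_linear_form f S v g" and b: "bij_betw b T S"
  shows "max_linear_form f T (v \<circ> b) g"
proof -
  have S: "S = b ` T" "inj_on b T" using b by (auto simp: bij_betw_def)
  have "(v \<circ> b) ` (T - {i}) = v ` (S - {b i})" if "i \<in> T" for i
    using that S by (auto simp: image_iff inj_on_eq_iff) 
  moreover have "inj_on (v \<circ> b) T"
    using f S by (auto simp: max_linear_form_def intro: comp_inj_on)
  moreover have "(\<lambda>i. (v \<circ> b) i \<bullet> x) ` T = (\<lambda>i. v i \<bullet> x) ` S" for x
    by (auto simp: S)
  moreover have "finite T" "T \<noteq> {}"
    using f S(1) bij_betw_finite[OF b] by (auto simp: max_linear_form_def)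
  ultimately show ?thesis
    using f S(1) by (simp add: max_linear_form_def)
qed

text \<open>Fewer vectors have a smaller convex hull, so none enters the hull of the others. For the
  active indices this makes the local pattern accessible to convergence in pattern.\<close>

lemma max_linear_form_subset:
  fixes v :: "'i \<Rightarrow> real ^ 'p"
  assumes f: "max_linear_form f S v g" and I: "I \<subseteq> S" "I \<noteq> {}"
  shows "max_linear_form (\<lambda>x. Max ((\<lambda>i. v i \<bullet> x) ` I)) I v (\<lambda>_. 0)"
proof -
  have "v i \<notin> convex hull (v ` (I - {i}))" if "i \<in> I" for i
  proof -
    have "convex hull (v ` (I - {i})) \<subseteq> convex hull (v ` (S - {i}))"
      using I by (intro hull_mono) blast
    then show ?thesis using f I that by (auto simp: max_linear_form_def)
  qed
  moreover have "continuously_differentiable (\<lambda>_ :: real ^ 'p. 0)"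
    unfolding continuously_differentiable_def
    by (intro exI[of _ "\<lambda>_. 0"]) (simp add: GDERIV_const)
  ultimately show ?thesis
    using f I by (auto simp: max_linear_form_def convex_on_const intro: finite_subset inj_on_subset)
qed

text \<open>The definition ranges over index sets of naturals; a bijection onto \<open>S\<close>
  carries each pattern event to an equal one.\<close>

lemma converges_weakly_in_patternD:
  fixes S :: "'i set"
  assumes conv: "converges_weakly_in_pattern M X N Y"
    and h: "max_linear_form h S v g" and p: "p \<in> range (pattern S v)"
  shows "(\<lambda>n. measure (M n) {\<omega> \<in> space (M n). pattern S v (X n \<omega>) = p})
      \<longlonglongrightarrow> measure N {\<omega> \<in> space N. pattern S v (Y \<omega>) = p}"
proof -
  have "finite S" using h by (simp add: max_linear_form_def)
  then obtain b :: "nat \<Rightarrow> 'i" and T where b: "bij_betw b T S"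
    using ex_bij_betw_nat_finite by blast
  obtain x where x: "p = pattern S v x" using p by blast
  have iff: "pattern T (v \<circ> b) y = pattern T (v \<circ> b) x \<longleftrightarrow> pattern S v y = p" for y
  proof -
    have "inj_on b T" using b by (simp add: bij_betw_def)
    then have "b ` pattern T (v \<circ> b) y = b ` pattern T (v \<circ> b) x \<longleftrightarrow>
        pattern T (v \<circ> b) y = pattern T (v \<circ> b) x"
      by (rule inj_on_image_eq_iff) (rule pattern_subset)+
    then show ?thesis by (simp only: pattern_reindex[OF b] x)
  qed
  have "(\<lambda>n. measure (M n) {\<omega> \<in> space (M n). pattern T (v \<circ> b) (X n \<omega>) = pattern T (v \<circ> b) x})
      \<longlonglongrightarrow> measure N {\<omega> \<in> space N. pattern T (v \<circ> b) (Y \<omega>) = pattern T (v \<circ> b) x}"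
    using conv max_linear_form_reindex[OF h b] unfolding converges_weakly_in_pattern_def by blast
  then show ?thesis by (simp only: iff)
qed

text \<open>For large \<open>n\<close>, the estimator has the pattern of \<open>x\<close> exactly
  when the rescaled error ties all active indices, except on an event of small probability supplied
  by tightness.\<close>

lemma pattern_probability_limit:
  fixes X :: "nat \<Rightarrow> 'a \<Rightarrow> real ^ 'p" and u :: "'w \<Rightarrow> real ^ 'p"
  assumes f: "max_linear_form f S v g"
    and M: "\<And>n. prob_space (M n)" and N: "prob_space N"
    and X: "\<And>n. X n \<in> borel_measurable (M n)" and u: "u \<in> borel_measurable N"
    and weak: "converges_weakly M (\<lambda>n \<omega>. sqrt (real n) *\<^sub>R (X n \<omega> - x)) N u"
    and pat: "converges_weakly_in_pattern M (\<lambda>n \<omega>. sqrt (real n) *\<^sub>R (X n \<omega> - x)) N u"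
  shows "(\<lambda>n. measure (M n) {\<omega> \<in> space (M n). pattern S v (X n \<omega>) = pattern S v x})
      \<longlonglongrightarrow> measure N {\<omega> \<in> space N. u \<omega> \<in> pattern_space S v x}"
proof -
  let ?I = "pattern S v x"
  let ?Z = "\<lambda>n \<omega>. sqrt (real n) *\<^sub>R (X n \<omega> - x)"
  let ?A = "\<lambda>n. {\<omega> \<in> space (M n). pattern S v (X n \<omega>) = ?I}"
  let ?B = "\<lambda>n. {\<omega> \<in> space (M n). pattern ?I v (?Z n \<omega>) = ?I}"
  have S: "finite S" "S \<noteq> {}" using f by (auto simp: max_linear_form_def)
  have I: "finite ?I" "?I \<noteq> {}"
    by (rule finite_subset[OF pattern_subset S(1)], rule pattern_nonempty[OF S])
  have Z: "?Z n \<in> borel_measurable (M n)" for n using X[of n] by measurable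
  \<comment> \<open>The zero vector ties all active indices, so \<open>?I\<close> is an attained
    pattern of the subfamily, as convergence in pattern requires.\<close>
  have "pattern ?I v 0 = ?I" by (auto simp: pattern_def)
  then have "?I \<in> range (pattern ?I v)" by (metis rangeI)
  then have B: "(\<lambda>n. measure (M n) (?B n)) \<longlonglongrightarrow> measure N {\<omega> \<in> space N. pattern ?I v (u \<omega>) = ?I}"
    by (rule converges_weakly_in_patternD[OF pat max_linear_form_subset[OF f pattern_subset I(2)]])
  have diff: "(\<lambda>n. measure (M n) (?A n) - measure (M n) (?B n)) \<longlonglongrightarrow> 0"
  proof (rule tendstoI)
    fix e :: real assume e: "e > 0"
    obtain k where k: "\<forall>\<^sub>F n in sequentially. measure (M n) {\<omega> \<in> space (M n). norm (?Z n \<omega>) \<ge> k} < e"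
      using converges_weakly_tight[OF weak M N Z u e] by blast
    obtain d where d: "d > 0" "\<And>y. norm y < d \<Longrightarrow> pattern S v (x + y) = pattern ?I v y"
      using pattern_add_local[OF S, of v x] by blast
    have "filterlim (\<lambda>n. sqrt (real n)) at_top sequentially"
      by (rule filterlim_compose[OF sqrt_at_top filterlim_real_sequentially])
    \<comment> \<open>The bound by \<open>k / d\<close> puts the unscaled error within distance
      \<open>d\<close> whenever the scaled one is below \<open>k\<close>; the bound by 0 excludes
      \<open>n = 0\<close>, where the scaling degenerates.\<close>
    then have "\<forall>\<^sub>F n in sequentially. sqrt (real n) > max 0 (k / d)"
      by (simp only: filterlim_at_top_dense)
    with k show "\<forall>\<^sub>F n in sequentially. dist (measure (M n) (?A n) - measure (M n) (?B n)) 0 < e"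
    proof eventually_elim
      case (elim n)
      interpret M: prob_space "M n" by (rule M)
      let ?D = "{\<omega> \<in> space (M n). norm (?Z n \<omega>) \<ge> k}"
      have n: "sqrt (real n) > 0" "k < d * sqrt (real n)"
        using elim(2) d(1) by (auto simp: field_simps)
      have "{\<omega> \<in> space (M n). k \<le> norm (?Z n \<omega>)} \<in> sets (M n)"
        by (intro borel_measurable_le borel_measurable_const
            measurable_compose[OF Z borel_measurable_norm])
      then have sets: "?A n \<in> sets (M n)" "?B n \<in> sets (M n)" "?D \<in> sets (M n)"
        by (auto intro: sets_pattern_eq[OF S(1) X] sets_pattern_eq[OF I(1) Z])
      have same: "pattern S v (X n \<omega>) = pattern ?I v (?Z n \<omega>)" if "norm (?Z n \<omega>) < k" for \<omega>
      proof -
        have "sqrt (real n) * norm (X n \<omega> - x) < k" using that by simp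
        also have "\<dots> < sqrt (real n) * d" using n(2) by (simp only: mult.commute)
        finally have "norm (X n \<omega> - x) < d" by (rule mult_left_less_imp_less) simp
        then show ?thesis using d(2)[of "X n \<omega> - x"] n(1) by (simp add: pattern_scaleR)
      qed
      \<comment> \<open>The two events differ only inside \<open>?D\<close>, so their probabilities
        differ by less than \<open>e\<close>.\<close>
      have "measure (M n) (?A n) \<le> measure (M n) (?B n \<union> ?D)"
        "measure (M n) (?B n) \<le> measure (M n) (?A n \<union> ?D)"
        using sets same by (auto intro!: M.finite_measure_mono simp: not_le[symmetric])
      moreover have "measure (M n) (?B n \<union> ?D) \<le> measure (M n) (?B n) + measure (M n) ?D"
        "measure (M n) (?A n \<union> ?D) \<le> measure (M n) (?A n) + measure (M n) ?D"
        using sets by (auto intro!: measure_Un_le)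
      ultimately show ?case using elim(1) by (simp add: dist_real_def abs_less_iff)
    qed
  qed
  show ?thesis
    using tendsto_add[OF diff B] by (simp add: pattern_space_eq[OF S])
qed

section \<open>The exponential bound for the recovery probability\<close>

theorem corollary3p7:
  fixes \<beta>\<^sub>0 :: "real ^ 'p"
    and f :: "real ^ 'p \<Rightarrow> real"
    and S :: "'i set" and v :: "'i \<Rightarrow> real ^ 'p" and g :: "real ^ 'p \<Rightarrow> real"
    and C :: "real ^ 'p ^ 'p"
    and N :: "'w measure" and W :: "'w \<Rightarrow> real ^ 'p"
    and M :: "nat \<Rightarrow> 'a measure"
    and \<beta>hat :: "real \<Rightarrow> nat \<Rightarrow> 'a \<Rightarrow> real ^ 'p"
    and uhat :: "real \<Rightarrow> 'w \<Rightarrow> real ^ 'p"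
    and v\<^sub>0 :: "real ^ 'p"
  assumes "max_linear_form f S v g"
    and "positive_definite C"
    and "prob_space N"
    and "integrable N W" and "integral\<^sup>L N W = 0"
    and "\<And>i. sub_gaussian N (\<lambda>\<omega>. W \<omega> $ i)"
    and "\<And>n. prob_space (M n)"
    and "\<And>\<alpha> n. \<alpha> > 0 \<Longrightarrow> \<beta>hat \<alpha> n \<in> borel_measurable (M n)"
    and "\<And>\<alpha>. \<alpha> > 0 \<Longrightarrow> uhat \<alpha> \<in> borel_measurable N"
    and "\<And>\<alpha> \<omega>. \<alpha> > 0 \<Longrightarrow> \<omega> \<in> space N \<Longrightarrow>
           is_arg_min (limit_objective C f \<beta>\<^sub>0 \<alpha> (W \<omega>)) (\<lambda>_. True) (uhat \<alpha> \<omega>)"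
    and "\<And>\<alpha>. \<alpha> > 0 \<Longrightarrow>
           converges_weakly M (\<lambda>n \<omega>. sqrt (real n) *\<^sub>R (\<beta>hat \<alpha> n \<omega> - \<beta>\<^sub>0)) N (uhat \<alpha>)"
    and "\<And>\<alpha>. \<alpha> > 0 \<Longrightarrow>
           converges_weakly_in_pattern M (\<lambda>n \<omega>. sqrt (real n) *\<^sub>R (\<beta>hat \<alpha> n \<omega> - \<beta>\<^sub>0)) N (uhat \<alpha>)"
    and "v\<^sub>0 \<in> subdifferential f \<beta>\<^sub>0"
    and "matrix_sqrt C *v
           orth_proj ((*v) (matrix_sqrt C) ` pattern_space S v \<beta>\<^sub>0)
             (matrix_inv (matrix_sqrt C) *v v\<^sub>0)
         \<in> rel_interior (subdifferential f \<beta>\<^sub>0)"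
  shows "\<exists>c>0. \<forall>\<alpha>>0. \<exists>L.
           (\<lambda>n. measure (M n)
              {\<omega> \<in> space (M n). pattern S v (\<beta>hat \<alpha> n \<omega>) = pattern S v \<beta>\<^sub>0}) \<longlonglongrightarrow> L \<and>
           L \<ge> 1 - 2 * exp (- c * \<alpha>\<^sup>2)"
proof -
  interpret N: prob_space N by fact
  \<comment> \<open>Both \<open>r\<close> and the tail constant \<open>a\<close> are fixed before
    \<open>\<alpha>\<close>, so the final constant \<open>a * r^2\<close> does not depend on
    it.\<close>
  obtain r where r: "r > 0" "\<And>\<alpha> w u. \<alpha> > 0 \<Longrightarrow> norm w < r * \<alpha> \<Longrightarrow>
      is_arg_min (limit_objective C f \<beta>\<^sub>0 \<alpha> w) (\<lambda>_. True) u \<Longrightarrow> u \<in> pattern_space S v \<beta>\<^sub>0"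
    using pattern_recovery[OF assms(1,2) assms(14)] by blast
  obtain a where a: "a > 0"
    "\<And>t. t \<ge> 0 \<Longrightarrow> measure N {\<omega> \<in> space N. norm (W \<omega>) \<ge> t} \<le> 2 * exp (- a * t\<^sup>2)"
    using sub_gaussian_norm_tail[OF assms(3) assms(6)] by blast
  have "\<exists>L. (\<lambda>n. measure (M n)
              {\<omega> \<in> space (M n). pattern S v (\<beta>hat \<alpha> n \<omega>) = pattern S v \<beta>\<^sub>0}) \<longlonglongrightarrow> L \<and>
           L \<ge> 1 - 2 * exp (- (a * r\<^sup>2) * \<alpha>\<^sup>2)" if \<alpha>: "\<alpha> > 0" for \<alpha>
  proof (intro exI conjI)
    show "(\<lambda>n. measure (M n)
        {\<omega> \<in> space (M n). pattern S v (\<beta>hat \<alpha> n \<omega>) = pattern S v \<beta>\<^sub>0})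
      \<longlonglongrightarrow> measure N {\<omega> \<in> space N. uhat \<alpha> \<omega> \<in> pattern_space S v \<beta>\<^sub>0}"
      using \<alpha> by (intro pattern_probability_limit[OF assms(1,7,3)] assms)
    have W: "W \<in> borel_measurable N" using assms(4) by simp
    have U: "pattern_space S v \<beta>\<^sub>0 \<in> sets borel"
      by (intro borel_closed closed_subspace) (simp add: pattern_space_def)
    \<comment> \<open>The tail bound is used at \<open>t = r * \<alpha>\<close>; on the
      complementary event the minimizer lies in the pattern space.\<close>
    have "1 - 2 * exp (- (a * r\<^sup>2) * \<alpha>\<^sup>2) \<le> 1 - measure N {\<omega> \<in> space N. norm (W \<omega>) \<ge> r * \<alpha>}"
      using a(2)[of "r * \<alpha>"] r(1) \<alpha> by (simp add: power_mult_distrib mult_ac)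
    also have "\<dots> = measure N {\<omega> \<in> space N. norm (W \<omega>) < r * \<alpha>}"
      using N.prob_neg[of "\<lambda>\<omega>. norm (W \<omega>) \<ge> r * \<alpha>"] W by (simp add: not_le)
    also have "\<dots> \<le> measure N {\<omega> \<in> space N. uhat \<alpha> \<omega> \<in> pattern_space S v \<beta>\<^sub>0}"
    proof (rule N.finite_measure_mono)
      show "{\<omega> \<in> space N. norm (W \<omega>) < r * \<alpha>} \<subseteq> {\<omega> \<in> space N. uhat \<alpha> \<omega> \<in> pattern_space S v \<beta>\<^sub>0}"
        using r(2)[OF \<alpha> _ assms(10)[OF \<alpha>]] by blast
      show "{\<omega> \<in> space N. uhat \<alpha> \<omega> \<in> pattern_space S v \<beta>\<^sub>0} \<in> sets N"
        using measurable_sets[OF assms(9)[OF \<alpha>] U] by (simp add: vimage_def Int_def conj_commute)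
    qed
    finally show "1 - 2 * exp (- (a * r\<^sup>2) * \<alpha>\<^sup>2)
        \<le> measure N {\<omega> \<in> space N. uhat \<alpha> \<omega> \<in> pattern_space S v \<beta>\<^sub>0}" .
  qed
  then show ?thesis
    using a(1) r(1) by (intro exI[of _ "a * r\<^sup>2"]) auto
qed

end
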